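(* Let $\mu$ be a monotone measure on $(X,\mathcal{A})$, let $\triangledown\colon\mu(\mathcal{A})\times\mu(\mathcal{A})\to\mu(\mathcal{A})$, let $\star$ be a link map that is continuous in the first argument, let $\mathrm{P}$ be the operation $x\,\mathrm{P}\,y=x$, and let $f,g\colon X\to Y$ be measurable. Suppose that for each $\circledast\in\{\star,\mathrm{P}\}$, $$[(a+b)\wedge\bar y]\vee\big[(\alpha\,\triangledown\,\beta)\circledast((c+d)\wedge\bar y)\big]\le[a\vee(\alpha\circledast c)]+[b\vee(\beta\circledast d)]$$ for all $a,b,c,d\in Y$ and $\alpha,\beta\in\mu(\mathcal{A})$. If $f,g$ are $\mu$-$\triangledown$-subadditive and $f+g$ takes values in $Y$, then for all $n\ge1$ $$\mathrm{Su}_{\star}^{n}(\mu,f+g)\le\mathrm{Su}_{\star}^{n}(\mu,f)+\mathrm{Su}_{\star}^{n}(\mu,g).\qquad( * )$$ Moreover, if $( * )$ is valid for all measurable $f,g\colon X\to Y$ such that $f+g$ takes values in $Y$, and for $n$ such that $\mu^{\star}_n(X)>0$, then the monotone measure $\mu^{\star}_n$ is subadditive, i.e. $\mu^{\star}_n(A\cup B)\le\mu^{\star}_n(A)+\mu^{\star}_n(B)$ for all $A,B\in\mathcal{A}$.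
   Context: $(X,\mathcal{A})$ is a measurable space with $X\neq\emptyset$ ($\mathcal{A}$ a $\sigma$-algebra), and $Y=[0,\bar y]$ with $0<\bar y\le\infty$. Notation: $a\wedge b=\min(a,b)$, $a\vee b=\max(a,b)$, $\{f\ge t\}=\{x\in X: f(x)\ge t\}$ and similarly $\{f>t\}$; $\mu(\mathcal{A})$ is the range of $\mu$. A monotone measure on $(X,\mathcal{A})$ is a set function $\mu\colon\mathcal{A}\to[0,\infty]$ with $\mu(A)\le\mu(B)$ whenever $A\subset B$, $\mu(\emptyset)=0$ and $\mu(X)>0$. Functions $f,g$ are $\mu$-$\triangledown$-subadditive if $\mu(\{f>a\}\cup\{g>b\})\le\mu(\{f>a\})\,\triangledown\,\mu(\{g>b\})$ for all $a,b\in Y$. A link map is a nondecreasing map $\star\colon[0,\infty]\times Y\to[0,\infty]$ (i.e. $a_1\star a_2\le b_1\star b_2$ whenever $a_i\le b_i$) such that $0\star a\le a$ for all $a\in Y$. The lower $n$-Sugeno integral of a measurable $f\colon X\to Y$ is defined recursively by $$\mathrm{Su}_{\star}^{1}(\mu,f)=\sup_{t\in Y}\{t\wedge\mu(\{f\ge t\})\},\qquad \mathrm{Su}_{\star}^{n+1}(\mu,f)=\sup_{t\in Y}\big\{t\wedge\big(\mu(\{f\ge t\})\star\mathrm{Su}_{\star}^{n}(\mu,f)\big)\big\}.$$ The set functions $\mu^{\star}_k$ are defined by $\mu^{\star}_1(A)=\mu(A)$ and $\mu^{\star}_{k+1}(A)=\mu(A)\star\mu^{\star}_k(A)$ for $A\in\mathcal{A}$,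 $k\ge1$; whenever this notation is used it is assumed that $\mu^{\star}_k(X)\in Y$ for all $k$. The set function $\mu_n^\star$ is a monotone measure if $\mu^{\star}_n(X)>0$. *)

theory Defs
  imports "HOL-Analysis.Analysis"
begin

text \<open>A measurable space is represented by a term \<open>M\<close> of the library type \<open>measure\<close>, of which only
  \<open>space M\<close> and \<open>sets M\<close> are used; \<open>\<mu>\<close> is an unrelated set function.  The interval \<open>Y\<close> is
  \<open>{0..ybar}\<close> in \<open>ennreal\<close>.  Binary operations with domain \<open>Y\<close> or \<open>\<mu> ` sets M\<close> are total functions
  on \<open>ennreal\<close>, constrained only on their domain.\<close>

definition monotone_measure :: "'a measure \<Rightarrow> ('a set \<Rightarrow> ennreal) \<Rightarrow> bool" where
  "monotone_measure M \<mu> \<longleftrightarrow>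
     (\<forall>A\<in>sets M. \<forall>B\<in>sets M. A \<subseteq> B \<longrightarrow> \<mu> A \<le> \<mu> B) \<and> \<mu> {} = 0 \<and> \<mu> (space M) > 0"

definition subadditive_on_sets :: "'a measure \<Rightarrow> ('a set \<Rightarrow> ennreal) \<Rightarrow> bool" where
  "subadditive_on_sets M \<mu> \<longleftrightarrow> (\<forall>A\<in>sets M. \<forall>B\<in>sets M. \<mu> (A \<union> B) \<le> \<mu> A + \<mu> B)"

definition op_subadditive ::
  "'a measure \<Rightarrow> ennreal \<Rightarrow> ('a set \<Rightarrow> ennreal) \<Rightarrow> (ennreal \<Rightarrow> ennreal \<Rightarrow> ennreal)
     \<Rightarrow> ('a \<Rightarrow> ennreal) \<Rightarrow> ('a \<Rightarrow> ennreal) \<Rightarrow> bool" where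
  "op_subadditive M ybar \<mu> nabla f g \<longleftrightarrow>
     (\<forall>a\<in>{0..ybar}. \<forall>b\<in>{0..ybar}.
        \<mu> ({x\<in>space M. f x > a} \<union> {x\<in>space M. g x > b})
          \<le> nabla (\<mu> {x\<in>space M. f x > a}) (\<mu> {x\<in>space M. g x > b}))"

definition link_map :: "ennreal \<Rightarrow> (ennreal \<Rightarrow> ennreal \<Rightarrow> ennreal) \<Rightarrow> bool" where
  "link_map ybar star \<longleftrightarrow>
     (\<forall>a1 b1. \<forall>a2\<in>{0..ybar}. \<forall>b2\<in>{0..ybar}.
        a1 \<le> b1 \<longrightarrow> a2 \<le> b2 \<longrightarrow> star a1 a2 \<le> star b1 b2) \<and>
     (\<forall>a\<in>{0..ybar}. star 0 a \<le> a)"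

definition first_proj :: "ennreal \<Rightarrow> ennreal \<Rightarrow> ennreal" where
  "first_proj x y = x"

text \<open>Both recursions start at index 1; the value at index 0 is a dummy.\<close>

fun lower_Sugeno ::
  "'a measure \<Rightarrow> ennreal \<Rightarrow> (ennreal \<Rightarrow> ennreal \<Rightarrow> ennreal) \<Rightarrow> nat
     \<Rightarrow> ('a set \<Rightarrow> ennreal) \<Rightarrow> ('a \<Rightarrow> ennreal) \<Rightarrow> ennreal" where
  "lower_Sugeno M ybar star 0 \<mu> f = 0"
| "lower_Sugeno M ybar star (Suc 0) \<mu> f =
     (SUP t\<in>{0..ybar}. min t (\<mu> {x\<in>space M. f x \<ge> t}))"
| "lower_Sugeno M ybar star (Suc (Suc n)) \<mu> f =
     (SUP t\<in>{0..ybar}.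
        min t (star (\<mu> {x\<in>space M. f x \<ge> t}) (lower_Sugeno M ybar star (Suc n) \<mu> f)))"

fun iter_measure ::
  "(ennreal \<Rightarrow> ennreal \<Rightarrow> ennreal) \<Rightarrow> nat \<Rightarrow> ('a set \<Rightarrow> ennreal) \<Rightarrow> 'a set \<Rightarrow> ennreal" where
  "iter_measure star 0 \<mu> A = 0"
| "iter_measure star (Suc 0) \<mu> A = \<mu> A"
| "iter_measure star (Suc (Suc k)) \<mu> A = star (\<mu> A) (iter_measure star (Suc k) \<mu> A)"

lemma iter_measure_mono:
  assumes "monotone_measure M \<mu>" "link_map ybar star"
    and Y: "\<And>k. k \<ge> 1 \<Longrightarrow> iter_measure star k \<mu> (space M) \<in> {0..ybar}"
    and "A \<in> sets M" "B \<in> sets M" "A \<subseteq> B"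
  shows "iter_measure star (Suc k) \<mu> A \<le> iter_measure star (Suc k) \<mu> B"
  using assms(4-6)
proof (induction k arbitrary: A B)
  case 0
  then show ?case using assms(1) by (auto simp: monotone_measure_def)
next
  case (Suc k)
  have "iter_measure star (Suc k) \<mu> C \<in> {0..ybar}" if "C \<in> sets M" for C
    using Suc.IH[OF that sets.top sets.sets_into_space[OF that]] Y[of "Suc k"] by auto
  moreover have "\<mu> A \<le> \<mu> B"
    using Suc.prems assms(1) by (auto simp: monotone_measure_def)
  ultimately show ?case
    using Suc assms(2) unfolding link_map_def iter_measure.simps by blast
qed

lemma monotone_measure_iter_measure:
  assumes "monotone_measure M \<mu>" "link_map ybar star"
    and "\<And>k. k \<ge> 1 \<Longrightarrow> iter_measure star k \<mu> (space M) \<in> {0..ybar}"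
    and "n \<ge> 1" "iter_measure star n \<mu> (space M) > 0"
  shows "monotone_measure M (iter_measure star n \<mu>)"
proof -
  obtain m where n: "n = Suc m" using assms(4) by (cases n) auto
  have "iter_measure star (Suc k) \<mu> {} = 0" for k
  proof (induction k)
    case 0
    then show ?case using assms(1) by (simp add: monotone_measure_def)
  next
    case (Suc k)
    have "star 0 0 \<le> 0" using assms(2) unfolding link_map_def by (meson atLeastAtMost_iff zero_le)
    then show ?case using Suc assms(1) by (simp add: monotone_measure_def)
  qed
  then show ?thesis
    using iter_measure_mono[OF assms(1-3)] assms(5)
    unfolding monotone_measure_def n by auto
qed

end

theory Submission
  imports Defs
begin

text \<open>
  Subadditivity of the lower Sugeno integral rests on trading its supremum for an infimum,
  \<open>sup\<^sub>t t \<and> (\<mu>{f \<ge> t} \<star> s) = inf\<^sub>t t \<or> (\<mu>{f > t} \<star> s)\<close> with \<open>t\<close> in \<open>Y\<close>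
  (lemma \<open>sup_min_eq_inf_max\<close>). A bound of the form \<open>S\<^sub>f\<^sub>+\<^sub>g \<le> S\<^sub>f + S\<^sub>g\<close> is awkward for
  suprema, where a level of \<open>f + g\<close> would have to be split into a level of \<open>f\<close> and one of \<open>g\<close>.
  For infima the levels combine instead: arbitrary \<open>a\<close> and \<open>b\<close> are admissible on the right, and
  the level \<open>(a + b) \<and> ybar\<close> is tested on the left, where
  \<open>{f + g > (a + b) \<and> ybar} \<subseteq> {f > a} \<union> {g > b}\<close>. The assumed inequality between \<open>\<star>\<close> and
  \<open>\<nabla>\<close> compares precisely the resulting terms (lemma \<open>Sugeno_step_subadditive\<close>). The claim
  for all \<open>n\<close> follows by induction; the start \<open>n = 1\<close> is the same step for the first projection,
  which turns the recursion step into the ordinary Sugeno integral.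

  For the converse, the integral of \<open>ybar\<close> times the indicator of \<open>A\<close> is \<open>\<mu>\<^sub>n A\<close>
  (lemma \<open>lower_Sugeno_indicator\<close>), so subadditivity of the integral for the disjoint sets
  \<open>A\<close> and \<open>B - A\<close> yields subadditivity of \<open>\<mu>\<^sub>n\<close> by monotonicity.
\<close>

section \<open>The Sugeno integral as an infimum\<close>

text \<open>Both sides locate the point where the decreasing function \<open>h\<close> crosses the diagonal; passing
  from \<open>h\<close> to a function \<open>k\<close> caught between \<open>h\<close> and its right limits does not move that point. The
  bound on \<open>k y\<close> makes \<open>y\<close> an upper bound of the infimum when the crossing lies beyond the
  interval.\<close>

lemma sup_min_eq_inf_max:
  fixes h k :: "'b::{complete_linorder, dense_linorder} \<Rightarrow> 'b"
  assumes le: "\<And>t. t \<le> y \<Longrightarrow> k t \<le> h t"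
    and less: "\<And>t u. t < u \<Longrightarrow> u \<le> y \<Longrightarrow> h u \<le> k t"
    and end_point: "k y \<le> y"
  shows "(SUP t\<in>{bot..y}. min t (h t)) = (INF t\<in>{bot..y}. max t (k t))" (is "?S = ?I")
proof (rule antisym)
  have "min u (h u) \<le> max t (k t)" if "t \<le> y" "u \<le> y" for t u
    using less[of t u] that by (cases "t < u") (auto simp: min_le_iff_disj le_max_iff_disj)
  then show "?S \<le> ?I" by (auto intro!: SUP_least INF_greatest)
next
  show "?I \<le> ?S"
  proof (rule dense_ge)
    fix z assume z: "?S < z"
    show "?I \<le> z"
    proof (cases "z \<le> y")
      case True
      have "min z (h z) \<le> ?S" using True by (intro SUP_upper) auto
      then have "h z \<le> z" using z by (auto simp: min_def split: if_splits)
      then have "max z (k z) \<le> z" using le[OF True] by auto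
      then show ?thesis using True by (auto intro: INF_lower2[of z])
    next
      case False
      then have "max y (k y) \<le> z" using end_point by auto
      then show ?thesis by (auto intro: INF_lower2[of y])
    qed
  qed
qed

lemma ennreal_le_add_INF:
  fixes c s :: ennreal
  assumes "\<And>b. b \<in> A \<Longrightarrow> s \<le> c + q b"
  shows "s \<le> c + (INF b\<in>A. q b)"
proof (cases "c = top")
  case False
  then have "s - c \<le> (INF b\<in>A. q b)"
    using assms by (intro INF_greatest) (simp add: ennreal_minus_le_iff)
  then show ?thesis using False by (simp add: ennreal_minus_le_iff)
qed simp

lemma ennreal_le_INF_add_INF:
  fixes p q :: "'b \<Rightarrow> ennreal"
  assumes "\<And>a b. a \<in> A \<Longrightarrow> b \<in> B \<Longrightarrow> s \<le> p a + q b"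
  shows "s \<le> (INF a\<in>A. p a) + (INF b\<in>B. q b)"
  using ennreal_le_add_INF[of A s "INF b\<in>B. q b" p] ennreal_le_add_INF[of B s "p _" q] assms
  by (simp add: add.commute)

lemma level_sets_measurable:
  assumes "f \<in> M \<rightarrow>\<^sub>M restrict_space borel {0..ybar::ennreal}"
  shows "{x\<in>space M. t \<le> f x} \<in> sets M" "{x\<in>space M. t < f x} \<in> sets M"
proof -
  have [measurable]: "f \<in> borel_measurable M"
    using assms measurable_restrict_space2_iff by blast
  show "{x\<in>space M. t \<le> f x} \<in> sets M" "{x\<in>space M. t < f x} \<in> sets M"
    by measurable
qed

lemma link_mapD:
  assumes "link_map ybar opr"
  shows "\<And>\<alpha> \<beta> c d. \<alpha> \<le> \<beta> \<Longrightarrow> c \<le> d \<Longrightarrow> d \<le> ybar \<Longrightarrow> opr \<alpha> c \<le> opr \<beta> d"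
    and "\<And>c. c \<le> ybar \<Longrightarrow> opr 0 c \<le> c"
  using assms unfolding link_map_def by (auto intro: order_trans)

text \<open>The parameter \<open>c\<close> stands for the previous integral in the recursion. With the first
  projection as operation this is the ordinary Sugeno integral, so one lemma serves both the start
  of the induction and its step.\<close>

definition Sugeno_step ::
  "'a measure \<Rightarrow> ennreal \<Rightarrow> (ennreal \<Rightarrow> ennreal \<Rightarrow> ennreal) \<Rightarrow> ('a set \<Rightarrow> ennreal)
     \<Rightarrow> ('a \<Rightarrow> ennreal) \<Rightarrow> ennreal \<Rightarrow> ennreal" where
  "Sugeno_step M ybar opr \<mu> f c = (SUP t\<in>{0..ybar}. min t (opr (\<mu> {x\<in>space M. f x \<ge> t}) c))"

lemma lower_Sugeno_1: "lower_Sugeno M ybar star (Suc 0) \<mu> f = Sugeno_step M ybar first_proj \<mu> f 0"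
  by (simp add: Sugeno_step_def first_proj_def)

lemma lower_Sugeno_Suc_Suc:
  "lower_Sugeno M ybar star (Suc (Suc n)) \<mu> f
     = Sugeno_step M ybar star \<mu> f (lower_Sugeno M ybar star (Suc n) \<mu> f)"
  by (simp add: Sugeno_step_def)

lemma Sugeno_step_le: "Sugeno_step M ybar opr \<mu> f c \<le> ybar"
  unfolding Sugeno_step_def by (auto intro!: SUP_least simp: min_le_iff_disj)

lemma lower_Sugeno_le: "lower_Sugeno M ybar star n \<mu> f \<le> ybar"
proof (cases n)
  case (Suc m)
  then show ?thesis
    by (cases m) (simp_all add: lower_Sugeno_1 lower_Sugeno_Suc_Suc Sugeno_step_le
        del: lower_Sugeno.simps)
qed simp

text \<open>The functions \<open>h\<close> and \<open>k\<close> above are the weak and the strict level sets measured. The end point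
  condition holds because \<open>{f > ybar}\<close> is empty and a link map satisfies \<open>0 \<star> c \<le> c\<close>.\<close>

lemma Sugeno_step_eq_INF:
  assumes \<mu>: "monotone_measure M \<mu>" and opr: "link_map ybar opr" and c: "c \<le> ybar"
    and f: "f \<in> M \<rightarrow>\<^sub>M restrict_space borel {0..ybar}"
  shows "Sugeno_step M ybar opr \<mu> f c
    = (INF t\<in>{0..ybar}. max t (opr (\<mu> {x\<in>space M. f x > t}) c))"
proof -
  have mono: "opr (\<mu> A) c \<le> opr (\<mu> B) c" if "A \<in> sets M" "B \<in> sets M" "A \<subseteq> B" for A B
    using \<mu> that c by (auto intro!: link_mapD[OF opr] simp: monotone_measure_def)
  have f_le: "f x \<le> ybar" if "x \<in> space M" for x
    using measurable_space[OF f that] by simp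
  then have empty: "{x\<in>space M. ybar < f x} = {}"
    by (metis (mono_tags, lifting) Collect_empty_eq leD)
  have "opr (\<mu> {x\<in>space M. ybar < f x}) c \<le> ybar"
    using \<mu> order_trans[OF link_mapD(2)[OF opr c] c] unfolding empty monotone_measure_def by metis
  then show ?thesis
    unfolding Sugeno_step_def
    by (intro sup_min_eq_inf_max[where 'b=ennreal, unfolded bot_ennreal] mono
        level_sets_measurable[OF f]) auto
qed

section \<open>Subadditivity of the integral\<close>

text \<open>With both integrals on the right written as infima it suffices to bound the left side by
  \<open>(a \<or> \<dots>) + (b \<or> \<dots>)\<close> for each pair of levels \<open>a\<close>, \<open>b\<close>, and the level \<open>(a + b) \<and> ybar\<close> of
  \<open>f + g\<close> does this. Truncating at \<open>ybar\<close> keeps the level in \<open>Y\<close>, and costs nothing because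
  \<open>f + g\<close> never exceeds \<open>ybar\<close>.\<close>

lemma Sugeno_step_subadditive:
  fixes ybar :: ennreal
  assumes \<mu>: "monotone_measure M \<mu>" and opr: "link_map ybar opr"
    and f: "f \<in> M \<rightarrow>\<^sub>M restrict_space borel {0..ybar}"
    and g: "g \<in> M \<rightarrow>\<^sub>M restrict_space borel {0..ybar}"
    and ineq: "\<And>a b \<alpha> \<beta>. a \<in> {0..ybar} \<Longrightarrow> b \<in> {0..ybar} \<Longrightarrow>
           \<alpha> \<in> \<mu> ` sets M \<Longrightarrow> \<beta> \<in> \<mu> ` sets M \<Longrightarrow>
           max (min (a + b) ybar) (opr (nabla \<alpha> \<beta>) (min (c + d) ybar))
             \<le> max a (opr \<alpha> c) + max b (opr \<beta> d)"
    and sub: "op_subadditive M ybar \<mu> nabla f g"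
    and fg: "\<And>x. x \<in> space M \<Longrightarrow> f x + g x \<le> ybar"
    and c: "c \<le> ybar" and d: "d \<le> ybar" and e: "e \<le> c + d" "e \<le> ybar"
  shows "Sugeno_step M ybar opr \<mu> (\<lambda>x. f x + g x) e
    \<le> Sugeno_step M ybar opr \<mu> f c + Sugeno_step M ybar opr \<mu> g d"
proof -
  have [measurable]: "f \<in> borel_measurable M" "g \<in> borel_measurable M"
    using f g measurable_restrict_space2_iff by blast+
  have sum: "(\<lambda>x. f x + g x) \<in> M \<rightarrow>\<^sub>M restrict_space borel {0..ybar}"
    using fg by (auto intro!: measurable_restrict_space2)
  have "Sugeno_step M ybar opr \<mu> (\<lambda>x. f x + g x) e
      \<le> max a (opr (\<mu> {x\<in>space M. f x > a}) c) + max b (opr (\<mu> {x\<in>space M. g x > b}) d)"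
    if ab: "a \<in> {0..ybar}" "b \<in> {0..ybar}" for a b
  proof -
    let ?t = "min (a + b) ybar"
    let ?A = "{x\<in>space M. f x > a}" and ?B = "{x\<in>space M. g x > b}"
    let ?C = "{x\<in>space M. f x + g x > ?t}"
    have "?C \<subseteq> ?A \<union> ?B"
    proof
      fix x assume x: "x \<in> ?C"
      then have "a + b < f x + g x"
        using fg[of x] by (auto simp: min_less_iff_disj not_less[symmetric])
      then have "\<not> (f x \<le> a \<and> g x \<le> b)" using add_mono[of "f x" a "g x" b] leD by blast
      then show "x \<in> ?A \<union> ?B" using x by auto
    qed
    then have "\<mu> ?C \<le> \<mu> (?A \<union> ?B)"
      using \<mu> by (simp add: monotone_measure_def)
    also have "\<dots> \<le> nabla (\<mu> ?A) (\<mu> ?B)"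
      using sub ab by (simp add: op_subadditive_def)
    finally have "opr (\<mu> ?C) e \<le> opr (nabla (\<mu> ?A) (\<mu> ?B)) (min (c + d) ybar)"
      using e by (intro link_mapD[OF opr]) auto
    then have "max ?t (opr (\<mu> ?C) e) \<le> max a (opr (\<mu> ?A) c) + max b (opr (\<mu> ?B) d)"
      using ineq[OF ab, of "\<mu> ?A" "\<mu> ?B"]
      by (rule order_trans[OF max.mono[OF order_refl]]) auto
    moreover have "Sugeno_step M ybar opr \<mu> (\<lambda>x. f x + g x) e \<le> max ?t (opr (\<mu> ?C) e)"
      unfolding Sugeno_step_eq_INF[OF \<mu> opr e(2) sum] by (intro INF_lower) auto
    ultimately show ?thesis by order
  qed
  then show ?thesis
    unfolding Sugeno_step_eq_INF[OF \<mu> opr c f] Sugeno_step_eq_INF[OF \<mu> opr d g]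
    by (rule ennreal_le_INF_add_INF)
qed

section \<open>Integrals of indicators\<close>

text \<open>All level sets \<open>{f \<ge> t}\<close> with \<open>0 < t \<le> ybar\<close> equal \<open>A\<close>, and the level \<open>0\<close> contributes \<open>0\<close>, so
  each supremum is attained at \<open>t = ybar\<close>, where the minimum cuts nothing off because of the bound
  on \<open>\<mu>\<^sub>k A\<close>. The function is described by its values on \<open>space M\<close> so that sums of such functions
  for disjoint sets are covered as well.\<close>

lemma lower_Sugeno_indicator:
  assumes A: "A \<subseteq> space M"
    and f: "\<And>x. x \<in> space M \<Longrightarrow> f x = (if x \<in> A then ybar else 0)"
    and le: "\<And>k. iter_measure star (Suc k) \<mu> A \<le> ybar"
  shows "lower_Sugeno M ybar star (Suc n) \<mu> f = iter_measure star (Suc n) \<mu> A"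
proof (induction n)
  have level: "{x\<in>space M. t \<le> f x} = A" if "0 < t" "t \<le> ybar" for t
    using A f that by (auto simp: subset_eq split: if_splits)
  have sup: "(SUP t\<in>{0..ybar}. min t (F {x\<in>space M. f x \<ge> t})) = F A"
    if F: "F A \<le> ybar" for F :: "'a set \<Rightarrow> ennreal"
  proof (rule antisym)
    have "min t (F {x\<in>space M. f x \<ge> t}) \<le> F A" if "t \<le> ybar" for t
      using level[of t] that by (cases "t = 0") (auto simp: zero_less_iff_neq_zero)
    then show "(SUP t\<in>{0..ybar}. min t (F {x\<in>space M. f x \<ge> t})) \<le> F A"
      by (auto intro: SUP_least)
    have "F A \<le> min ybar (F {x\<in>space M. f x \<ge> ybar})"
      using level[of ybar] F by (cases "ybar = 0") (auto simp: zero_less_iff_neq_zero)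
    then show "F A \<le> (SUP t\<in>{0..ybar}. min t (F {x\<in>space M. f x \<ge> t}))"
      by (rule order_trans) (auto intro: SUP_upper)
  qed
  {
    case 0
    show ?case using sup[of \<mu>] le[of 0] by simp
  next
    case (Suc n)
    show ?case
      using sup[of "\<lambda>B. star (\<mu> B) (iter_measure star (Suc n) \<mu> A)"] le[of "Suc n"] Suc
      by simp
  }
qed

section \<open>Subadditive integrals and subadditive iterated measures\<close>

theorem theorem4p7:
  fixes M :: "'a measure" and ybar :: ennreal
    and \<mu> :: "'a set \<Rightarrow> ennreal"
    and nabla star :: "ennreal \<Rightarrow> ennreal \<Rightarrow> ennreal"
    and f g :: "'a \<Rightarrow> ennreal"
  assumes "space M \<noteq> {}" and "0 < ybar"
    and "monotone_measure M \<mu>"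
    and "\<And>\<alpha> \<beta>. \<alpha> \<in> \<mu> ` sets M \<Longrightarrow> \<beta> \<in> \<mu> ` sets M \<Longrightarrow> nabla \<alpha> \<beta> \<in> \<mu> ` sets M"
    and "link_map ybar star"
    and "\<And>y. y \<in> {0..ybar} \<Longrightarrow> continuous_on UNIV (\<lambda>x. star x y)"
    and "f \<in> M \<rightarrow>\<^sub>M restrict_space borel {0..ybar}"
    and "g \<in> M \<rightarrow>\<^sub>M restrict_space borel {0..ybar}"
    and "\<And>opr a b c d \<alpha> \<beta>.
           opr \<in> {star, first_proj} \<Longrightarrow>
           a \<in> {0..ybar} \<Longrightarrow> b \<in> {0..ybar} \<Longrightarrow> c \<in> {0..ybar} \<Longrightarrow> d \<in> {0..ybar} \<Longrightarrow>
           \<alpha> \<in> \<mu> ` sets M \<Longrightarrow> \<beta> \<in> \<mu> ` sets M \<Longrightarrow>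
           max (min (a + b) ybar) (opr (nabla \<alpha> \<beta>) (min (c + d) ybar))
             \<le> max a (opr \<alpha> c) + max b (opr \<beta> d)"
  shows "(op_subadditive M ybar \<mu> nabla f g \<longrightarrow> (\<forall>x\<in>space M. f x + g x \<in> {0..ybar}) \<longrightarrow>
            (\<forall>n\<ge>1. lower_Sugeno M ybar star n \<mu> (\<lambda>x. f x + g x)
                      \<le> lower_Sugeno M ybar star n \<mu> f + lower_Sugeno M ybar star n \<mu> g))
       \<and> ((\<forall>k\<ge>1. iter_measure star k \<mu> (space M) \<in> {0..ybar}) \<longrightarrow>
            (\<forall>n\<ge>1. iter_measure star n \<mu> (space M) > 0 \<longrightarrow>
               (\<forall>f \<in> M \<rightarrow>\<^sub>M restrict_space borel {0..ybar}.
                \<forall>g \<in> M \<rightarrow>\<^sub>M restrict_space borel {0..ybar}.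
                  (\<forall>x\<in>space M. f x + g x \<in> {0..ybar}) \<longrightarrow>
                  lower_Sugeno M ybar star n \<mu> (\<lambda>x. f x + g x)
                    \<le> lower_Sugeno M ybar star n \<mu> f + lower_Sugeno M ybar star n \<mu> g) \<longrightarrow>
               subadditive_on_sets M (iter_measure star n \<mu>)))"
proof (intro conjI impI allI ballI)
  fix n :: nat
  assume sub: "op_subadditive M ybar \<mu> nabla f g"
    and fg: "\<forall>x\<in>space M. f x + g x \<in> {0..ybar}" and "1 \<le> n"
  have proj: "link_map ybar first_proj"
    by (simp add: link_map_def first_proj_def)
  have step: "Sugeno_step M ybar opr \<mu> (\<lambda>x. f x + g x) e
      \<le> Sugeno_step M ybar opr \<mu> f c + Sugeno_step M ybar opr \<mu> g d"
    if "opr \<in> {star, first_proj}" "c \<le> ybar" "d \<le> ybar" "e \<le> c + d" "e \<le> ybar" for opr c d e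
  proof (rule Sugeno_step_subadditive[OF assms(3) _ assms(7,8) _ sub _ that(2-5)])
    show "link_map ybar opr" using that(1) proj assms(5) by auto
    show "max (min (a + b) ybar) (opr (nabla \<alpha> \<beta>) (min (c + d) ybar))
        \<le> max a (opr \<alpha> c) + max b (opr \<beta> d)"
      if "a \<in> {0..ybar}" "b \<in> {0..ybar}" "\<alpha> \<in> \<mu> ` sets M" "\<beta> \<in> \<mu> ` sets M" for a b \<alpha> \<beta>
    proof -
      have "c \<in> {0..ybar}" "d \<in> {0..ybar}"
        using \<open>c \<le> ybar\<close> \<open>d \<le> ybar\<close> by simp_all
      from assms(9)[OF \<open>opr \<in> {star, first_proj}\<close> that(1,2) this that(3,4)] show ?thesis .
    qed
  qed (use fg in auto)
  have "lower_Sugeno M ybar star (Suc m) \<mu> (\<lambda>x. f x + g x)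
      \<le> lower_Sugeno M ybar star (Suc m) \<mu> f + lower_Sugeno M ybar star (Suc m) \<mu> g" for m
  proof (induction m)
    case 0
    show ?case unfolding lower_Sugeno_1 by (rule step) auto
  next
    case (Suc m)
    then show ?case unfolding lower_Sugeno_Suc_Suc by (intro step lower_Sugeno_le) auto
  qed
  from this[of "n - 1"] \<open>1 \<le> n\<close>
  show "lower_Sugeno M ybar star n \<mu> (\<lambda>x. f x + g x)
      \<le> lower_Sugeno M ybar star n \<mu> f + lower_Sugeno M ybar star n \<mu> g" by simp
next
  fix n :: nat
  assume Y: "\<forall>k\<ge>1. iter_measure star k \<mu> (space M) \<in> {0..ybar}" and "1 \<le> n"
    and sub: "\<forall>f \<in> M \<rightarrow>\<^sub>M restrict_space borel {0..ybar}.
      \<forall>g \<in> M \<rightarrow>\<^sub>M restrict_space borel {0..ybar}.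
        (\<forall>x\<in>space M. f x + g x \<in> {0..ybar}) \<longrightarrow>
        lower_Sugeno M ybar star n \<mu> (\<lambda>x. f x + g x)
          \<le> lower_Sugeno M ybar star n \<mu> f + lower_Sugeno M ybar star n \<mu> g"
  obtain m where n: "n = Suc m" using \<open>1 \<le> n\<close> by (cases n) auto
  have mono: "iter_measure star (Suc k) \<mu> A \<le> iter_measure star (Suc k) \<mu> B"
    if "A \<in> sets M" "B \<in> sets M" "A \<subseteq> B" for A B k
    using iter_measure_mono[OF assms(3,5)] Y that by blast
  have le: "iter_measure star (Suc k) \<mu> A \<le> ybar" if "A \<in> sets M" for A k
    using mono[OF that sets.top sets.sets_into_space[OF that], of k] Y[rule_format, of "Suc k"]
    by auto
  show "subadditive_on_sets M (iter_measure star n \<mu>)"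
    unfolding subadditive_on_sets_def
  proof (intro ballI)
    fix A B assume AB [measurable]: "A \<in> sets M" "B \<in> sets M"
    let ?f = "\<lambda>C x. if x \<in> C then ybar else 0"
    have meas: "?f C \<in> M \<rightarrow>\<^sub>M restrict_space borel {0..ybar}" if [measurable]: "C \<in> sets M" for C
      by (intro measurable_restrict_space2) auto
    have int: "lower_Sugeno M ybar star n \<mu> h = iter_measure star n \<mu> C"
      if "C \<in> sets M" "\<And>x. h x = ?f C x" for C h
      unfolding n using that le sets.sets_into_space[OF that(1)]
      by (intro lower_Sugeno_indicator) auto
    \<comment> \<open>Taking \<open>B - A\<close> in place of \<open>B\<close> keeps the sum of the two functions within \<open>Y\<close>.\<close>
    have "iter_measure star n \<mu> (A \<union> B)
        = lower_Sugeno M ybar star n \<mu> (\<lambda>x. ?f A x + ?f (B - A) x)"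
      by (rule int[symmetric]) auto
    also have "\<dots> \<le> lower_Sugeno M ybar star n \<mu> (?f A) + lower_Sugeno M ybar star n \<mu> (?f (B - A))"
      by (intro sub[rule_format] meas) auto
    also have "\<dots> = iter_measure star n \<mu> A + iter_measure star n \<mu> (B - A)"
      using int[OF AB(1)] int[of "B - A"] by simp
    also have "\<dots> \<le> iter_measure star n \<mu> A + iter_measure star n \<mu> B"
      unfolding n by (intro add_left_mono mono) auto
    finally show "iter_measure star n \<mu> (A \<union> B) \<le> iter_measure star n \<mu> A + iter_measure star n \<mu> B" .
  qed
qed

end
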